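(* Let $v$ be a sampling vector and $g(x)=\nabla f_v(x)$. If each $f_i$ is $L_i$-smooth and there exists $x^*\in\mathcal{X}^*$ such that every $f_i$ is $x^*$-convex, then $g\in\mathrm{ER}(\rho)$ for some constant $\rho$. If in addition $v$ is the $b$-minibatch sampling, then the expected residual constant $\rho=\rho(b)$ and the gradient noise $\sigma^2=\sigma^2(b)$ are given by $$\rho(b)=L_{\max}\frac{n-b}{(n-1)b},\qquad \sigma^2(b)=\frac1b\,\frac{n-b}{n-1}\,\sigma_1^2,$$ where $\sigma_1^2:=\sup_{x^*\in\mathcal{X}^*}\frac1n\sum_{i=1}^n\|\nabla f_i(x^* )\|^2$.
   Context: $f_1,\dots,f_n:\mathbb{R}^d\to\mathbb{R}$ are differentiable, $f=\frac1n\sum_i f_i$, and the set $\mathcal{X}^*$ of global minimizers of $f$ is nonempty. A sampling vector is a random vector $v\in\mathbb{R}^n$ with nonnegative entries and $\mathbb{E}[v_i]=1$ for all $i$. $f_v=\frac1n\sum_i v_if_i$ and $g(x)=\nabla f_v(x)$. The $b$-minibatch sampling ($b\in\{1,\dots,n\}$) is the random vector with $\mathbb{P}[v=\frac nb\sum_{i\in S}e_i]=1/\binom nb$ for every $S\subset\{1,\dots,n\}$ with $|S|=b$ ($e_i$ are the standard basis vectors). The gradient noise is $\sigma^2:=\sup_{x^*\in\mathcal{X}^*}\mathbb{E}\|g(x^* )\|^2$. $f_i$ is $L_i$-smooth if $f_i(z)-f_i(x)\le\langle\nabla f_i(x),z-x\rangle+\frac{L_i}2\|z-x\|^2$ for all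 $x,z\in\mathbb{R}^d$; $L_{\max}=\max_{i}L_i$. For $x^*\in\mathcal{X}^*$, $f_i$ is $x^*$-convex if $f_i(x^* )-f_i(x)\le\langle\nabla f_i(x^* ),x^*-x\rangle$ for all $x\in\mathbb{R}^d$. $g\in\mathrm{ER}(\rho)$ (expected residual condition) means: for all $x\in\mathbb{R}^d$, $\mathbb{E}\|g(x)-g(x^* )-(\nabla f(x)-\nabla f(x^* ))\|^2\le 2\rho(f(x)-f(x^* ))$.
   Formalization: The first claim additionally assumes E‖g(x)‖² is finite for every x; without such a condition it fails (n=1, f(x)=x²/2, E[v]=1, E[v²]=∞). The minibatch claim needs no such assumption. *)

theory Defs
  imports "HOL-Probability.Probability"
begin

text \<open>
  The component functions are indexed by a finite type \<open>'n\<close>, so that \<open>n = CARD('n)\<close>; points live in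
  \<open>real ^ 'd\<close> and sampling vectors in \<open>real ^ 'n\<close>.
\<close>

text \<open>Only meaningful at points of differentiability, where the gradient exists and is unique.\<close>

definition gradient :: "('a::euclidean_space \<Rightarrow> real) \<Rightarrow> 'a \<Rightarrow> 'a" where
  "gradient h x = (THE D. GDERIV h x :> D)"

lemma gradient_eqI:
  fixes h :: "'a::euclidean_space \<Rightarrow> real"
  assumes "GDERIV h x :> D"
  shows "gradient h x = D"
  unfolding gradient_def
proof (rule the_equality)
  fix D' assume "GDERIV h x :> D'"
  with assms have "(\<lambda>u. inner u D') = (\<lambda>u. inner u D)"
    unfolding gderiv_def by (rule has_derivative_unique[rotated])
  then show "D' = D"
    by (metis vector_eq_ldot)
qed (rule assms)

definition objective :: "('n::finite \<Rightarrow> 'a \<Rightarrow> real) \<Rightarrow> 'a \<Rightarrow> real" where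
  "objective f x = (1 / real CARD('n)) * (\<Sum>i\<in>UNIV. f i x)"

definition weighted_objective :: "('n::finite \<Rightarrow> 'a \<Rightarrow> real) \<Rightarrow> real ^ 'n \<Rightarrow> 'a \<Rightarrow> real" where
  "weighted_objective f w x = (1 / real CARD('n)) * (\<Sum>i\<in>UNIV. w $ i * f i x)"

definition minimizers :: "('a \<Rightarrow> real) \<Rightarrow> 'a set" where
  "minimizers h = {x. \<forall>y. h x \<le> h y}"

definition L_smooth :: "real \<Rightarrow> ('a::euclidean_space \<Rightarrow> real) \<Rightarrow> bool" where
  "L_smooth L h \<longleftrightarrow>
     (\<forall>x z. h z - h x \<le> inner (gradient h x) (z - x) + L / 2 * (norm (z - x))\<^sup>2)"

definition convex_around :: "'a::euclidean_space \<Rightarrow> ('a \<Rightarrow> real) \<Rightarrow> bool" where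
  "convex_around xs h \<longleftrightarrow> (\<forall>x. h xs - h x \<le> inner (gradient h xs) (xs - x))"

definition sampling_vector :: "'w measure \<Rightarrow> ('w \<Rightarrow> real ^ 'n::finite) \<Rightarrow> bool" where
  "sampling_vector M v \<longleftrightarrow>
     v \<in> borel_measurable M \<and>
     (AE \<omega> in M. \<forall>i. 0 \<le> v \<omega> $ i) \<and>
     (\<forall>i. integrable M (\<lambda>\<omega>. v \<omega> $ i) \<and> (\<integral>\<omega>. v \<omega> $ i \<partial>M) = 1)"

definition minibatch_sampling :: "'w measure \<Rightarrow> nat \<Rightarrow> ('w \<Rightarrow> real ^ 'n::finite) \<Rightarrow> bool" where
  "minibatch_sampling M b v \<longleftrightarrow>
     1 \<le> b \<and> b \<le> CARD('n) \<and>
     v \<in> borel_measurable M \<and>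
     (\<forall>S :: 'n set. card S = b \<longrightarrow>
        measure M {\<omega> \<in> space M. v \<omega> = (real CARD('n) / real b) *\<^sub>R (\<Sum>i\<in>S. axis i 1)}
          = 1 / real (CARD('n) choose b))"

definition stochastic_gradient ::
    "('n::finite \<Rightarrow> 'a::euclidean_space \<Rightarrow> real) \<Rightarrow> ('w \<Rightarrow> real ^ 'n) \<Rightarrow> 'w \<Rightarrow> 'a \<Rightarrow> 'a" where
  "stochastic_gradient f v \<omega> x = gradient (weighted_objective f (v \<omega>)) x"

text \<open>
  The condition is required at every global minimizer. Integrability is part of it because the
  Bochner integral of a non-integrable function is 0.
\<close>

definition expected_residual ::
    "'w measure \<Rightarrow> ('a::euclidean_space \<Rightarrow> real) \<Rightarrow> ('w \<Rightarrow> 'a \<Rightarrow> 'a) \<Rightarrow> real \<Rightarrow> bool" where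
  "expected_residual M F g \<rho> \<longleftrightarrow>
     (\<forall>xs\<in>minimizers F. \<forall>x.
        integrable M (\<lambda>\<omega>. (norm (g \<omega> x - g \<omega> xs - (gradient F x - gradient F xs)))\<^sup>2) \<and>
        (\<integral>\<omega>. (norm (g \<omega> x - g \<omega> xs - (gradient F x - gradient F xs)))\<^sup>2 \<partial>M)
          \<le> 2 * \<rho> * (F x - F xs))"

text \<open>
  The two suprema below are taken in \<^typ>\<open>ennreal\<close>, so that no boundedness or integrability has
  to be presupposed for them to be meaningful.
\<close>

definition gradient_noise ::
    "'w measure \<Rightarrow> ('a::euclidean_space \<Rightarrow> real) \<Rightarrow> ('w \<Rightarrow> 'a \<Rightarrow> 'a) \<Rightarrow> ennreal" where
  "gradient_noise M F g =
     (SUP xs\<in>minimizers F. \<integral>\<^sup>+\<omega>. ennreal ((norm (g \<omega> xs))\<^sup>2) \<partial>M)"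

definition single_element_noise :: "('n::finite \<Rightarrow> 'a::euclidean_space \<Rightarrow> real) \<Rightarrow> ennreal" where
  "single_element_noise f =
     (SUP xs\<in>minimizers (objective f).
        ennreal ((1 / real CARD('n)) * (\<Sum>i\<in>UNIV. (norm (gradient (f i) xs))\<^sup>2)))"

end

theory Submission
  imports Defs
begin

text \<open>
  Smoothness and convexity around \<open>xs\<close> bound the squared gradient difference of \<open>f i\<close> between \<open>x\<close> and
  \<open>xs\<close> by \<open>2 * L i\<close> times the Bregman distance, and the Bregman distances average to
  \<open>objective f x - objective f xs\<close> since the gradients at a minimizer sum to \<open>0\<close>. It follows that all
  minimizers share the same component gradients, so convexity around one of them is convexity around
  each. The residual is linear in these gradient differences, hence its second moment is a quadratic
  form in them. For minibatches this form is computed by counting the subsets that contain one given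
  index and avoid another.
\<close>

section \<open>Gradients\<close>

text \<open>Riesz representation in coordinates: a linear functional is the inner product with the
  vector of its values on \<open>Basis\<close>.\<close>

lemma GDERIV_gradient:
  fixes h :: "'a::euclidean_space \<Rightarrow> real"
  assumes "h differentiable (at x)"
  shows "GDERIV h x :> gradient h x"
proof -
  obtain h' where h': "(h has_derivative h') (at x)"
    using assms by (auto simp: differentiable_def)
  then have lin: "linear h'"
    by (rule has_derivative_linear)
  have "h' = (\<lambda>u. inner u (\<Sum>b\<in>Basis. h' b *\<^sub>R b))"
  proof
    fix u
    have "h' u = h' (\<Sum>b\<in>Basis. inner u b *\<^sub>R b)"
      by (simp add: euclidean_representation)
    also have "\<dots> = (\<Sum>b\<in>Basis. inner u b * h' b)"
      by (simp add: linear_sum[OF lin] linear_cmul[OF lin])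
    also have "\<dots> = inner u (\<Sum>b\<in>Basis. h' b *\<^sub>R b)"
      by (simp add: inner_sum_right mult.commute)
    finally show "h' u = inner u (\<Sum>b\<in>Basis. h' b *\<^sub>R b)" .
  qed
  with h' have "GDERIV h x :> (\<Sum>b\<in>Basis. h' b *\<^sub>R b)"
    by (simp add: gderiv_def)
  then show ?thesis
    by (simp add: gradient_eqI)
qed

lemma GDERIV_weighted_objective:
  fixes f :: "'n::finite \<Rightarrow> 'a::euclidean_space \<Rightarrow> real"
  assumes "\<And>i. f i differentiable (at x)"
  shows "GDERIV (weighted_objective f w) x :>
           (1 / real CARD('n)) *\<^sub>R (\<Sum>i\<in>UNIV. w $ i *\<^sub>R gradient (f i) x)"
proof -
  have "(f i has_derivative (\<lambda>u. inner u (gradient (f i) x))) (at x)" for i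
    using GDERIV_gradient[OF assms] by (simp add: gderiv_def)
  then have "((\<lambda>y. (1 / real CARD('n)) * (\<Sum>i\<in>UNIV. w $ i * f i y)) has_derivative
      (\<lambda>u. (1 / real CARD('n)) * (\<Sum>i\<in>UNIV. w $ i * inner u (gradient (f i) x)))) (at x)"
    by (intro has_derivative_mult_right has_derivative_sum)
  then show ?thesis
    by (simp add: gderiv_def weighted_objective_def[abs_def] inner_sum_right)
qed

lemma objective_eq_weighted_objective: "objective f = weighted_objective f 1"
  by (auto simp: objective_def weighted_objective_def)

lemma stochastic_gradient_eq:
  fixes f :: "'n::finite \<Rightarrow> 'a::euclidean_space \<Rightarrow> real"
  assumes "\<And>i. f i differentiable (at x)"
  shows "stochastic_gradient f v \<omega> x =
           (1 / real CARD('n)) *\<^sub>R (\<Sum>i\<in>UNIV. v \<omega> $ i *\<^sub>R gradient (f i) x)"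
  unfolding stochastic_gradient_def by (rule gradient_eqI[OF GDERIV_weighted_objective[OF assms]])

lemma gradient_objective:
  fixes f :: "'n::finite \<Rightarrow> 'a::euclidean_space \<Rightarrow> real"
  assumes "\<And>i. f i differentiable (at x)"
  shows "gradient (objective f) x = (1 / real CARD('n)) *\<^sub>R (\<Sum>i\<in>UNIV. gradient (f i) x)"
  unfolding objective_eq_weighted_objective
  by (subst gradient_eqI[OF GDERIV_weighted_objective[OF assms]]) simp

lemma sum_gradient_minimizer:
  fixes f :: "'n::finite \<Rightarrow> 'a::euclidean_space \<Rightarrow> real"
  assumes diff: "\<And>i x. f i differentiable (at x)"
    and min: "x \<in> minimizers (objective f)"
  shows "(\<Sum>i\<in>UNIV. gradient (f i) x) = 0"
proof -
  define D where "D = (\<Sum>i\<in>UNIV. gradient (f i) x)"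
  have "GDERIV (objective f) x :> (1 / real CARD('n)) *\<^sub>R D"
    using GDERIV_weighted_objective[of f x 1, OF diff]
    by (simp add: objective_eq_weighted_objective D_def)
  then have "(\<lambda>u. inner u ((1 / real CARD('n)) *\<^sub>R D)) = (\<lambda>u. 0)"
    unfolding gderiv_def
    by (rule has_derivative_local_min) (use min in \<open>auto simp: minimizers_def\<close>)
  then have "inner D ((1 / real CARD('n)) *\<^sub>R D) = 0"
    by meson
  then show ?thesis
    by (simp add: D_def)
qed

section \<open>Smooth functions that are convex around a minimizer\<close>

lemma nonneg_quadratic_leading_coeff:
  fixes a b c :: real
  assumes "\<And>t. 0 \<le> a + b * t + c * t\<^sup>2"
  shows "0 \<le> c"
proof (rule ccontr)
  assume "\<not> 0 \<le> c"
  then have c: "c < 0" by simp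
  have a: "0 \<le> a" using assms[of 0] by simp
  \<comment> \<open>This \<open>t\<close> makes \<open>c * t\<^sup>2 = - (a + 1)\<close>; adding the
    inequalities at \<open>t\<close> and \<open>- t\<close> cancels the linear term and leaves
    \<open>0 \<le> - 2\<close>.\<close>
  define t where "t = sqrt ((a + 1) / - c)"
  have t2: "t\<^sup>2 = (a + 1) / - c"
    unfolding t_def using a c by (intro real_sqrt_pow2) (simp add: divide_nonneg_neg)
  have "0 \<le> 2 * (a + c * t\<^sup>2)"
    using assms[of t] assms[of "- t"] by simp
  also have "c * t\<^sup>2 = - (a + 1)"
    unfolding t2 using c by (simp add: field_simps)
  finally show False by simp
qed

text \<open>Both cases \<open>L > 0\<close> and \<open>L = 0\<close> compare \<open>h\<close> with its tangent at \<open>xs\<close> after a gradient step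
  from \<open>y\<close>; negative \<open>L\<close> is impossible because the Bregman distance from \<open>xs\<close> is nonnegative.\<close>

lemma gradient_difference_le_bregman:
  fixes h :: "'a::euclidean_space \<Rightarrow> real"
  assumes smooth: "L_smooth L h" and conv: "convex_around xs h"
  shows "(norm (gradient h y - gradient h xs))\<^sup>2
           \<le> 2 * L * (h y - h xs - inner (gradient h xs) (y - xs))"
proof -
  define G where "G = gradient h y - gradient h xs"
  define D where "D = h y - h xs - inner (gradient h xs) (y - xs)"
  \<comment> \<open>Smoothness bounds \<open>h (y + e)\<close> above by a quadratic centred at
    \<open>y\<close>, convexity bounds it below by the tangent at \<open>xs\<close>;
    \<open>key\<close> compares the two.\<close>
  have key: "0 \<le> D + inner G e + L / 2 * (norm e)\<^sup>2" for e
  proof -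
    have "h (y + e) - h y \<le> inner (gradient h y) e + L / 2 * (norm e)\<^sup>2"
      using smooth unfolding L_smooth_def by (metis add_diff_cancel_left')
    moreover have "h xs - h (y + e) \<le> inner (gradient h xs) (xs - (y + e))"
      using conv by (simp add: convex_around_def)
    ultimately show ?thesis
      by (simp add: G_def D_def inner_diff_left inner_diff_right inner_add_right)
  qed
  obtain e :: 'a where "e \<in> Basis"
    using nonempty_Basis by blast
  then have "0 \<le> D + inner G e * t + L / 2 * t\<^sup>2" for t
    using key[of "t *\<^sub>R e"] by (simp add: mult.commute)
  then have "0 \<le> L / 2"
    by (rule nonneg_quadratic_leading_coeff)
  then have L: "0 \<le> L" by simp
  have step: "0 \<le> D - t * (norm G)\<^sup>2 + L / 2 * t\<^sup>2 * (norm G)\<^sup>2" for t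
    using key[of "- t *\<^sub>R G"] by (simp add: power2_norm_eq_inner power_mult_distrib)
  have "(norm G)\<^sup>2 \<le> 2 * L * D"
  proof (cases "L = 0")
    case True
    have "(norm G)\<^sup>2 = 0"
    proof (rule ccontr)
      assume "(norm G)\<^sup>2 \<noteq> 0"
      \<comment> \<open>For \<open>L = 0\<close> the bound \<open>step\<close> is affine in
        \<open>t\<close> with slope \<open>- (norm G)\<^sup>2\<close>; this \<open>t\<close> brings
        it to \<open>- 1\<close>.\<close>
      then show False
        using step[of "(D + 1) / (norm G)\<^sup>2"] True by simp
    qed
    with True show ?thesis by simp
  next
    case False
    with L have "0 < L" by simp
    \<comment> \<open>\<open>t = 1 / L\<close> minimizes the right-hand side of \<open>step\<close>,
      whose value there is \<open>D - (norm G)\<^sup>2 / (2 * L)\<close>.\<close>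
    then show ?thesis
      using step[of "1 / L"] by (simp add: field_simps power2_eq_square)
  qed
  then show "(norm (gradient h y - gradient h xs))\<^sup>2
      \<le> 2 * L * (h y - h xs - inner (gradient h xs) (y - xs))"
    by (simp add: G_def D_def)
qed

lemma sum_bregman_minimizer:
  fixes f :: "'n::finite \<Rightarrow> 'a::euclidean_space \<Rightarrow> real"
  assumes diff: "\<And>i x. f i differentiable (at x)"
    and min: "xs \<in> minimizers (objective f)"
  shows "(\<Sum>i\<in>UNIV. f i x - f i xs - inner (gradient (f i) xs) (x - xs))
           = real CARD('n) * (objective f x - objective f xs)"
proof -
  have "(\<Sum>i\<in>UNIV. inner (gradient (f i) xs) (x - xs)) = 0"
    using sum_gradient_minimizer[OF diff min] by (simp flip: inner_sum_left)
  then show ?thesis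
    by (simp add: sum_subtractf objective_def right_diff_distrib)
qed

text \<open>The nonnegative Bregman distances from \<open>xs\<close> to \<open>ys\<close> sum to \<open>0\<close>, so each vanishes.\<close>

lemma convex_around_minimizers:
  fixes f :: "'n::finite \<Rightarrow> 'a::euclidean_space \<Rightarrow> real"
  assumes diff: "\<And>i x. f i differentiable (at x)"
    and smooth: "\<And>i. L_smooth (L i) (f i)"
    and conv: "\<And>i. convex_around xs (f i)"
    and xs: "xs \<in> minimizers (objective f)"
    and ys: "ys \<in> minimizers (objective f)"
  shows "convex_around ys (f i)"
proof -
  let ?B = "\<lambda>j. f j ys - f j xs - inner (gradient (f j) xs) (ys - xs)"
  have "objective f ys = objective f xs"
    using xs ys by (auto simp: minimizers_def intro: antisym)
  then have "sum ?B UNIV = 0"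
    using sum_bregman_minimizer[OF diff xs] by simp
  moreover have "0 \<le> ?B j" for j
    using conv[of j] unfolding convex_around_def
    by (smt (verit) inner_minus_right minus_diff_eq)
  ultimately have B: "?B i = 0"
    by (simp add: sum_nonneg_eq_0_iff)
  then have "gradient (f i) ys = gradient (f i) xs"
    using gradient_difference_le_bregman[OF smooth conv, of i ys] by simp
  moreover have "f i xs - f i x \<le> inner (gradient (f i) xs) (xs - x)" for x
    using conv by (simp add: convex_around_def)
  \<comment> \<open>Equal gradients and a zero Bregman distance make the tangents at
    \<open>xs\<close> and \<open>ys\<close> the same affine function, so the lower bound carries
    over.\<close>
  ultimately show ?thesis
    using B by (simp add: convex_around_def inner_diff_right) (smt (verit))
qed

text \<open>Summing \<open>gradient_difference_le_bregman\<close> turns the Bregman distances into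
  the objective gap. Their nonnegativity allows each \<open>L i\<close> to be replaced by the
  maximum.\<close>

lemma mean_gradient_difference_le:
  fixes f :: "'n::finite \<Rightarrow> 'a::euclidean_space \<Rightarrow> real"
  assumes diff: "\<And>i x. f i differentiable (at x)"
    and smooth: "\<And>i. L_smooth (L i) (f i)"
    and conv: "\<And>i. convex_around xs (f i)"
    and xs: "xs \<in> minimizers (objective f)"
  shows "(1 / real CARD('n)) * (\<Sum>i\<in>UNIV. (norm (gradient (f i) x - gradient (f i) xs))\<^sup>2)
           \<le> 2 * Max (range L) * (objective f x - objective f xs)"
proof -
  let ?B = "\<lambda>i. f i x - f i xs - inner (gradient (f i) xs) (x - xs)"
  have B: "0 \<le> ?B i" for i
    using conv[of i] unfolding convex_around_def
    by (smt (verit) inner_minus_right minus_diff_eq)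
  have "(\<Sum>i\<in>UNIV. (norm (gradient (f i) x - gradient (f i) xs))\<^sup>2)
      \<le> (\<Sum>i\<in>UNIV. 2 * Max (range L) * ?B i)"
  proof (rule sum_mono)
    fix i
    have "(norm (gradient (f i) x - gradient (f i) xs))\<^sup>2 \<le> 2 * L i * ?B i"
      by (rule gradient_difference_le_bregman[OF smooth conv])
    also have "\<dots> \<le> 2 * Max (range L) * ?B i"
      using B by (intro mult_right_mono) auto
    finally show "(norm (gradient (f i) x - gradient (f i) xs))\<^sup>2 \<le> 2 * Max (range L) * ?B i" .
  qed
  also have "\<dots> = 2 * Max (range L) * (real CARD('n) * (objective f x - objective f xs))"
    unfolding sum_bregman_minimizer[OF diff xs, symmetric] by (simp add: sum_distrib_left)
  finally show ?thesis
    by (simp add: field_simps)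
qed

section \<open>Second moments of linear images of a random vector\<close>

lemma integrable_power2_sum:
  fixes X :: "'i \<Rightarrow> 'w \<Rightarrow> real"
  assumes "finite I"
    and meas: "\<And>i. i \<in> I \<Longrightarrow> X i \<in> borel_measurable M"
    and int: "\<And>i. i \<in> I \<Longrightarrow> integrable M (\<lambda>\<omega>. (X i \<omega>)\<^sup>2)"
  shows "integrable M (\<lambda>\<omega>. (\<Sum>i\<in>I. X i \<omega>)\<^sup>2)"
proof (rule Bochner_Integration.integrable_bound)
  show "integrable M (\<lambda>\<omega>. (\<Sum>i\<in>I. (1::real)\<^sup>2) * (\<Sum>i\<in>I. (X i \<omega>)\<^sup>2))"
    using int by simp
  show "(\<lambda>\<omega>. (\<Sum>i\<in>I. X i \<omega>)\<^sup>2) \<in> borel_measurable M"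
    using meas by simp
  show "AE \<omega> in M. norm ((\<Sum>i\<in>I. X i \<omega>)\<^sup>2)
      \<le> norm ((\<Sum>i\<in>I. (1::real)\<^sup>2) * (\<Sum>i\<in>I. (X i \<omega>)\<^sup>2))"
    using Cauchy_Schwarz_ineq_sum[of "\<lambda>_. 1" "\<lambda>i. X i \<omega>" I for \<omega>] by (simp add: sum_nonneg)
qed

text \<open>The coordinates of \<open>u\<close> itself need not be square integrable: only the finite-dimensional
  subspace of those \<open>w\<close> for which \<open>w \<bullet> u\<close> is square integrable matters, and the second moment is a
  quadratic form on it.\<close>

lemma second_moment_bounded:
  fixes u :: "'w \<Rightarrow> 'a::euclidean_space"
  assumes meas: "u \<in> borel_measurable M"
  obtains C where "0 \<le> C"
    and "\<And>w. integrable M (\<lambda>\<omega>. (inner w (u \<omega>))\<^sup>2) \<Longrightarrow>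
           (\<integral>\<omega>. (inner w (u \<omega>))\<^sup>2 \<partial>M) \<le> C * (norm w)\<^sup>2"
proof -
  define W where "W = {w. integrable M (\<lambda>\<omega>. (inner w (u \<omega>))\<^sup>2)}"
  have [measurable]: "u \<in> borel_measurable M" by (rule meas)
  have "subspace W"
  proof (rule subspaceI)
    show "0 \<in> W" by (simp add: W_def)
  next
    fix x y assume xy: "x \<in> W" "y \<in> W"
    \<comment> \<open>The sum over \<open>bool\<close> presents \<open>x + y\<close> as a finite
      sum, to which \<open>integrable_power2_sum\<close> applies.\<close>
    have "integrable M (\<lambda>\<omega>. (\<Sum>b::bool\<in>UNIV. if b then inner x (u \<omega>) else inner y (u \<omega>))\<^sup>2)"
    proof (rule integrable_power2_sum)
      fix b :: bool
      show "(\<lambda>\<omega>. if b then inner x (u \<omega>) else inner y (u \<omega>)) \<in> borel_measurable M"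
        by measurable
      show "integrable M (\<lambda>\<omega>. (if b then inner x (u \<omega>) else inner y (u \<omega>))\<^sup>2)"
        using xy by (cases b) (auto simp: W_def)
    qed simp
    then show "x + y \<in> W"
      by (simp add: W_def UNIV_bool inner_add_left add.commute)
  next
    fix c x assume "x \<in> W"
    then show "c *\<^sub>R x \<in> W" by (simp add: W_def power_mult_distrib)
  qed
  then obtain B where B: "B \<subseteq> W" "pairwise orthogonal B" "\<And>x. x \<in> B \<Longrightarrow> norm x = 1"
      "independent B" "span B = W"
    by (metis orthonormal_basis_subspace)
  have finB: "finite B"
    using B(4) by (rule independent_imp_finite)
  \<comment> \<open>\<open>C\<close> comes from Cauchy-Schwarz in the orthonormal basis
    \<open>B\<close> of \<open>W\<close>; the factor \<open>card B\<close> appears because each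
    coefficient \<open>inner w b\<close> is bounded separately by \<open>norm w\<close>.\<close>
  define C where "C = real (card B) * (\<Sum>b\<in>B. \<integral>\<omega>. (inner b (u \<omega>))\<^sup>2 \<partial>M)"
  have intB: "integrable M (\<lambda>\<omega>. (inner b (u \<omega>))\<^sup>2)" if "b \<in> B" for b
    using that B(1) by (auto simp: W_def)
  show ?thesis
  proof
    show "0 \<le> C"
      by (simp add: C_def sum_nonneg)
    fix w assume w: "integrable M (\<lambda>\<omega>. (inner w (u \<omega>))\<^sup>2)"
    then have "w \<in> span B" by (simp add: B(5) W_def)
    then have rep: "w = (\<Sum>b\<in>B. inner w b *\<^sub>R b)"
    proof -
      obtain c where c: "w = (\<Sum>b\<in>B. c b *\<^sub>R b)"
        using \<open>w \<in> span B\<close> finB by (auto simp: span_finite)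
      have "inner w b = c b" if "b \<in> B" for b
      proof -
        have "inner w b = (\<Sum>b'\<in>B. c b' * inner b' b)"
          by (simp add: c inner_sum_left)
        also have "\<dots> = (\<Sum>b'\<in>B. if b' = b then c b else 0)"
          using B(2,3) that
          by (intro sum.cong) (auto simp: pairwise_def orthogonal_def dot_square_norm)
        also have "\<dots> = c b" using finB that by simp
        finally show ?thesis .
      qed
      then show ?thesis using c by simp
    qed
    have bound: "(inner w (u \<omega>))\<^sup>2
        \<le> (norm w)\<^sup>2 * real (card B) * (\<Sum>b\<in>B. (inner b (u \<omega>))\<^sup>2)" for \<omega>
    proof -
      have "(inner w (u \<omega>))\<^sup>2 = (\<Sum>b\<in>B. inner w b * inner b (u \<omega>))\<^sup>2"
        by (subst rep) (simp add: inner_sum_left)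
      also have "\<dots> \<le> (\<Sum>b\<in>B. (inner w b)\<^sup>2) * (\<Sum>b\<in>B. (inner b (u \<omega>))\<^sup>2)"
        by (rule Cauchy_Schwarz_ineq_sum)
      also have "\<dots> \<le> ((norm w)\<^sup>2 * real (card B)) * (\<Sum>b\<in>B. (inner b (u \<omega>))\<^sup>2)"
      proof (intro mult_right_mono sum_nonneg)
        have "(inner w b)\<^sup>2 \<le> (norm w)\<^sup>2" if "b \<in> B" for b
          using Cauchy_Schwarz_ineq2[of w b] B(3)[OF that]
            power_mono[of "\<bar>inner w b\<bar>" "norm w" 2] by simp
        then show "(\<Sum>b\<in>B. (inner w b)\<^sup>2) \<le> (norm w)\<^sup>2 * real (card B)"
          using sum_bounded_above[of B "\<lambda>b. (inner w b)\<^sup>2" "(norm w)\<^sup>2"] by (simp add: mult.commute)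
      qed simp
      finally show ?thesis .
    qed
    have "(\<integral>\<omega>. (inner w (u \<omega>))\<^sup>2 \<partial>M)
        \<le> (\<integral>\<omega>. (norm w)\<^sup>2 * real (card B) * (\<Sum>b\<in>B. (inner b (u \<omega>))\<^sup>2) \<partial>M)"
      using w intB bound by (intro integral_mono) auto
    also have "\<dots> = C * (norm w)\<^sup>2"
      using intB by (simp add: C_def)
    finally show "(\<integral>\<omega>. (inner w (u \<omega>))\<^sup>2 \<partial>M) \<le> C * (norm w)\<^sup>2" .
  qed
qed

lemma norm_power2_eq_sum_Basis:
  fixes x :: "'a::euclidean_space"
  shows "(norm x)\<^sup>2 = (\<Sum>k\<in>Basis. (inner x k)\<^sup>2)"
  unfolding power2_norm_eq_inner by (subst euclidean_inner) (simp add: power2_eq_square)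

text \<open>Reduction to scalars: the \<open>k\<close>-coordinate of the combination is the inner
  product of \<open>u\<close> with the vector of \<open>k\<close>-coordinates of the
  \<open>a i\<close>. The bound for such inner products is uniform in the direction, hence
  \<open>C\<close> does not depend on \<open>a\<close>.\<close>

lemma second_moment_combination_bounded:
  fixes u :: "'w \<Rightarrow> real ^ 'n::finite"
  assumes meas: "u \<in> borel_measurable M"
  obtains C where "0 \<le> C"
    and "\<And>a :: 'n \<Rightarrow> 'a::euclidean_space.
           integrable M (\<lambda>\<omega>. (norm (\<Sum>i\<in>UNIV. u \<omega> $ i *\<^sub>R a i))\<^sup>2) \<Longrightarrow>
           (\<integral>\<omega>. (norm (\<Sum>i\<in>UNIV. u \<omega> $ i *\<^sub>R a i))\<^sup>2 \<partial>M) \<le> C * (\<Sum>i\<in>UNIV. (norm (a i))\<^sup>2)"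
proof -
  obtain C where C: "0 \<le> C"
    and le: "\<And>w. integrable M (\<lambda>\<omega>. (inner w (u \<omega>))\<^sup>2) \<Longrightarrow>
           (\<integral>\<omega>. (inner w (u \<omega>))\<^sup>2 \<partial>M) \<le> C * (norm w)\<^sup>2"
    using second_moment_bounded[OF meas] by metis
  show ?thesis
  proof
    show "0 \<le> C" by (rule C)
    fix a :: "'n \<Rightarrow> 'a"
    assume int: "integrable M (\<lambda>\<omega>. (norm (\<Sum>i\<in>UNIV. u \<omega> $ i *\<^sub>R a i))\<^sup>2)"
    define w :: "'a \<Rightarrow> real ^ 'n" where "w k = (\<chi> i. inner (a i) k)" for k
    have [measurable]: "u \<in> borel_measurable M" by (rule meas)
    have w: "inner (\<Sum>i\<in>UNIV. u \<omega> $ i *\<^sub>R a i) k = inner (w k) (u \<omega>)" for \<omega> k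
      by (simp add: w_def inner_vec_def inner_sum_left mult.commute)
    have norm_eq: "(norm (\<Sum>i\<in>UNIV. u \<omega> $ i *\<^sub>R a i))\<^sup>2 = (\<Sum>k\<in>Basis. (inner (w k) (u \<omega>))\<^sup>2)" for \<omega>
      by (simp add: norm_power2_eq_sum_Basis w)
    have intk: "integrable M (\<lambda>\<omega>. (inner (w k) (u \<omega>))\<^sup>2)" if "k \<in> Basis" for k
    proof (rule Bochner_Integration.integrable_bound[OF int])
      show "(\<lambda>\<omega>. (inner (w k) (u \<omega>))\<^sup>2) \<in> borel_measurable M"
        by measurable
      show "AE \<omega> in M. norm ((inner (w k) (u \<omega>))\<^sup>2)
          \<le> norm ((norm (\<Sum>i\<in>UNIV. u \<omega> $ i *\<^sub>R a i))\<^sup>2)"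
        unfolding norm_eq using that
        by (auto simp: sum_nonneg intro!: member_le_sum)
    qed
    have "(\<integral>\<omega>. (norm (\<Sum>i\<in>UNIV. u \<omega> $ i *\<^sub>R a i))\<^sup>2 \<partial>M)
        = (\<Sum>k\<in>Basis. \<integral>\<omega>. (inner (w k) (u \<omega>))\<^sup>2 \<partial>M)"
      unfolding norm_eq using intk by (intro Bochner_Integration.integral_sum) auto
    also have "\<dots> \<le> (\<Sum>k\<in>Basis. C * (norm (w k))\<^sup>2)"
      using intk le by (intro sum_mono) auto
    also have "\<dots> = C * (\<Sum>i\<in>UNIV. (norm (a i))\<^sup>2)"
    proof -
      have "(norm (w k))\<^sup>2 = (\<Sum>i\<in>UNIV. (inner (a i) k)\<^sup>2)" for k
        unfolding power2_norm_eq_inner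
        by (simp add: w_def inner_vec_def power2_eq_square)
      then have "(\<Sum>k\<in>Basis. (norm (w k))\<^sup>2) = (\<Sum>i\<in>UNIV. \<Sum>k\<in>Basis. (inner (a i) k)\<^sup>2)"
        by (simp add: sum.swap[of _ UNIV])
      then show ?thesis
        by (simp add: norm_power2_eq_sum_Basis[of "a _"] flip: sum_distrib_left)
    qed
    finally show "(\<integral>\<omega>. (norm (\<Sum>i\<in>UNIV. u \<omega> $ i *\<^sub>R a i))\<^sup>2 \<partial>M)
        \<le> C * (\<Sum>i\<in>UNIV. (norm (a i))\<^sup>2)" .
  qed
qed

section \<open>Minibatch sampling\<close>

text \<open>Removing \<open>i\<close> from such a set leaves an arbitrary subset of size
  \<open>b - 1\<close> of the complement of \<open>{i, j}\<close>.\<close>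

lemma card_subsets_separating:
  fixes i j :: "'n::finite"
  assumes "i \<noteq> j" "1 \<le> b"
  shows "card {S :: 'n set. card S = b \<and> i \<in> S \<and> j \<notin> S} = (CARD('n) - 2) choose (b - 1)"
proof -
  have "bij_betw (insert i) {T. T \<subseteq> - {i, j} \<and> card T = b - 1}
      {S. card S = b \<and> i \<in> S \<and> j \<notin> S}"
  proof (rule bij_betw_byWitness[where f' = "\<lambda>S. S - {i}"])
    show "insert i ` {T. T \<subseteq> - {i, j} \<and> card T = b - 1} \<subseteq> {S. card S = b \<and> i \<in> S \<and> j \<notin> S}"
      using assms by (auto simp: card_insert_if)
  qed (use assms in auto)
  then have "card {S :: 'n set. card S = b \<and> i \<in> S \<and> j \<notin> S}
      = card {T. T \<subseteq> - {i, j} \<and> card T = b - 1}"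
    by (rule bij_betw_same_card[symmetric])
  also have "\<dots> = (card (- {i, j})) choose (b - 1)"
    by (rule n_subsets) simp
  also have "card (- {i, j}) = CARD('n) - 2"
    using assms by (simp add: Compl_eq_Diff_UNIV card_Diff_subset)
  finally show ?thesis .
qed

text \<open>Since the \<open>a i\<close> sum to \<open>0\<close>, the squared norm of the sum over \<open>S\<close> is minus the inner product of
  the sums over \<open>S\<close> and over its complement.\<close>

lemma sum_subsets_norm_power2:
  fixes a :: "'n::finite \<Rightarrow> 'a::real_inner"
  assumes b: "1 \<le> b" and a: "(\<Sum>i\<in>UNIV. a i) = 0"
  shows "(\<Sum>S | card S = b. (norm (\<Sum>i\<in>S. a i))\<^sup>2)
           = real ((CARD('n) - 2) choose (b - 1)) * (\<Sum>i\<in>UNIV. (norm (a i))\<^sup>2)"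
proof -
  let ?c = "real ((CARD('n) - 2) choose (b - 1))"
  have compl: "(norm (\<Sum>i\<in>S. a i))\<^sup>2
      = - (\<Sum>i\<in>UNIV. \<Sum>j\<in>UNIV. if i \<in> S \<and> j \<notin> S then inner (a i) (a j) else 0)" for S
  proof -
    have "(\<Sum>i\<in>S. a i) + (\<Sum>j\<in>-S. a j) = 0"
      using a sum.subset_diff[of S UNIV a] by (simp add: Compl_eq_Diff_UNIV add.commute)
    then have eq: "(\<Sum>i\<in>S. a i) = - (\<Sum>j\<in>-S. a j)"
      by (rule eq_neg_iff_add_eq_0[THEN iffD2])
    have "(norm (\<Sum>i\<in>S. a i))\<^sup>2 = inner (\<Sum>i\<in>S. a i) (\<Sum>i\<in>S. a i)"
      by (rule power2_norm_eq_inner)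
    also have "\<dots> = - inner (\<Sum>i\<in>S. a i) (\<Sum>j\<in>-S. a j)"
      by (subst (2) eq) simp
    also have "inner (\<Sum>i\<in>S. a i) (\<Sum>j\<in>-S. a j)
        = (\<Sum>i\<in>S. \<Sum>j\<in>-S. inner (a i) (a j))"
      by (subst inner_sum_left, subst inner_sum_right) (rule refl)
    also have "\<dots> = (\<Sum>i\<in>UNIV. if i \<in> S then \<Sum>j\<in>UNIV. if j \<in> -S then inner (a i) (a j) else 0 else 0)"
      by (simp add: sum.If_cases Compl_eq)
    also have "\<dots> = (\<Sum>i\<in>UNIV. \<Sum>j\<in>UNIV. if i \<in> S \<and> j \<notin> S then inner (a i) (a j) else 0)"
      by (intro sum.cong) auto
    finally show ?thesis .
  qed
  have pair: "(\<Sum>S | card S = b. if i \<in> S \<and> j \<notin> S then inner (a i) (a j) else 0)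
      = (if i = j then 0 else ?c * inner (a i) (a j))" for i j
  proof -
    have "(\<Sum>S | card S = b. if i \<in> S \<and> j \<notin> S then inner (a i) (a j) else 0)
        = real (card {S. card S = b \<and> i \<in> S \<and> j \<notin> S}) * inner (a i) (a j)"
      by (simp add: sum.If_cases Collect_conj_eq[symmetric])
    then show ?thesis
      using card_subsets_separating[OF _ b, of i j] by simp
  qed
  have "(\<Sum>S | card S = b. (norm (\<Sum>i\<in>S. a i))\<^sup>2)
      = - (\<Sum>i\<in>UNIV. \<Sum>j\<in>UNIV. \<Sum>S | card S = b.
            if i \<in> S \<and> j \<notin> S then inner (a i) (a j) else 0)"
    unfolding compl sum_negf
    by (subst sum.swap) (intro arg_cong[where f = uminus] sum.cong refl sum.swap)
  also have "\<dots> = - (\<Sum>i\<in>UNIV. \<Sum>j\<in>UNIV. if i = j then 0 else ?c * inner (a i) (a j))"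
    unfolding pair ..
  also have "\<dots> = (\<Sum>i\<in>UNIV. ?c * (norm (a i))\<^sup>2)"
    unfolding sum_negf[symmetric]
  proof (rule sum.cong[OF refl], goal_cases)
    case (1 i)
    \<comment> \<open>Adding back the diagonal term completes the row to the inner product of
      \<open>a i\<close> with the zero sum, so only minus the diagonal term remains.\<close>
    have "(\<Sum>j\<in>UNIV. if i = j then 0 else ?c * inner (a i) (a j))
        = (\<Sum>j\<in>UNIV. ?c * inner (a i) (a j)) - ?c * inner (a i) (a i)"
      by (simp add: sum.remove[of UNIV i] cong: if_cong)
    also have "(\<Sum>j\<in>UNIV. ?c * inner (a i) (a j)) = 0"
      using a by (simp flip: sum_distrib_left inner_sum_right)
    finally show ?case by (simp only: sum_negf power2_norm_eq_inner)
  qed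
  finally show ?thesis by (simp add: sum_distrib_left)
qed

text \<open>This is the variance of a sample mean without replacement; (n - b) / (n - 1) is the
  finite population correction.\<close>

lemma mean_subsets_norm_power2:
  fixes a :: "'n::finite \<Rightarrow> 'a::real_inner"
  assumes b: "1 \<le> b" "b \<le> CARD('n)" and a: "(\<Sum>i\<in>UNIV. a i) = 0"
  shows "(\<Sum>S | card S = b. (norm ((1 / real b) *\<^sub>R (\<Sum>i\<in>S. a i)))\<^sup>2) / real (CARD('n) choose b)
           = (real CARD('n) - real b) / ((real CARD('n) - 1) * real b)
             * ((1 / real CARD('n)) * (\<Sum>i\<in>UNIV. (norm (a i))\<^sup>2))"
proof (cases "CARD('n) = 1")
  \<comment> \<open>With a single index the zero sum forces \<open>a\<close> to vanish, so both
    sides are \<open>0\<close> although the denominator on the right is \<open>0\<close>.\<close>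
  case True
  then obtain k :: 'n where k: "UNIV = {k}"
    by (rule card_1_singletonE)
  have "a k = 0" using a unfolding k by simp
  moreover have "i = k" for i using k by blast
  ultimately have "a i = 0" for i by metis
  then show ?thesis by simp
next
  case False
  let ?n = "CARD('n)"
  have "?n > 0" by simp
  with False have n: "2 \<le> ?n" by linarith
  have "real b * real (?n choose b) = real ?n * real ((?n - 1) choose (b - 1))"
    using times_binomial_minus1_eq[of b ?n] b by (metis One_nat_def Suc_le_lessD of_nat_mult)
  moreover have "(real ?n - real b) * real ((?n - 1) choose (b - 1))
      = (real ?n - 1) * real ((?n - 2) choose (b - 1))"
  proof -
    have "(?n - 1 - (b - 1)) * ((?n - 1) choose (b - 1))
        = (?n - 1) * ((?n - 1 - 1) choose (b - 1))"
      by (rule binomial_absorb_comp)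
    moreover have "?n - 1 - (b - 1) = ?n - b" "?n - 1 - 1 = ?n - 2"
      using b n by auto
    ultimately have "real (?n - b) * real ((?n - 1) choose (b - 1))
        = real (?n - 1) * real ((?n - 2) choose (b - 1))"
      by (metis of_nat_mult)
    then show ?thesis using b n by (simp add: of_nat_diff)
  qed
  \<comment> \<open>Eliminating \<open>(?n - 1) choose (b - 1)\<close> between the two absorption
    identities relates the separating count to \<open>?n choose b\<close>.\<close>
  ultimately have "real ((?n - 2) choose (b - 1)) * (real ?n * (real ?n - 1))
      = real (?n choose b) * real b * (real ?n - real b)"
    by (smt (verit) mult.assoc mult.commute mult.left_commute)
  moreover have "0 < real (?n choose b)" "0 < real ?n" "0 < real ?n - 1" "0 < real b"
    using b n by auto
  ultimately have coeff: "real ((?n - 2) choose (b - 1)) / (real b)\<^sup>2 / real (?n choose b)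
      = (real ?n - real b) / ((real ?n - 1) * real b) * (1 / real ?n)"
    by (simp add: divide_simps power2_eq_square) (simp add: algebra_simps)
  have "(\<Sum>S | card S = b. (norm ((1 / real b) *\<^sub>R (\<Sum>i\<in>S. a i)))\<^sup>2)
      = real ((?n - 2) choose (b - 1)) / (real b)\<^sup>2 * (\<Sum>i\<in>UNIV. (norm (a i))\<^sup>2)"
    using sum_subsets_norm_power2[OF b(1) a]
    by (simp add: power_divide flip: sum_divide_distrib)
  then have "(\<Sum>S | card S = b. (norm ((1 / real b) *\<^sub>R (\<Sum>i\<in>S. a i)))\<^sup>2) / real (?n choose b)
      = real ((?n - 2) choose (b - 1)) / (real b)\<^sup>2 / real (?n choose b)
        * (\<Sum>i\<in>UNIV. (norm (a i))\<^sup>2)"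
    by simp
  then show ?thesis
    unfolding coeff by simp
qed

text \<open>\<open>minibatch_sampling\<close> only prescribes the probabilities of the listed
  values. These values are distinct and their probabilities add up to \<open>1\<close>, so almost
  surely \<open>v\<close> takes one of them and the expectation is a finite average.\<close>

lemma minibatch_has_bochner_integral:
  fixes v :: "'w \<Rightarrow> real ^ 'n::finite" and \<phi> :: "real ^ 'n \<Rightarrow> real"
  assumes "prob_space M" and mb: "minibatch_sampling M b v" and \<phi>: "\<phi> \<in> borel_measurable borel"
  shows "has_bochner_integral M (\<lambda>\<omega>. \<phi> (v \<omega>))
           ((\<Sum>S | card S = b. \<phi> ((real CARD('n) / real b) *\<^sub>R (\<Sum>i\<in>S. axis i 1)))
             / real (CARD('n) choose b))"
proof -
  interpret prob_space M by fact
  define V :: "'n set \<Rightarrow> real ^ 'n" where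
    "V S = (real CARD('n) / real b) *\<^sub>R (\<Sum>i\<in>S. axis i 1)" for S
  define A where "A S = {\<omega> \<in> space M. v \<omega> = V S}" for S
  have b: "1 \<le> b" "b \<le> CARD('n)" and [measurable]: "v \<in> borel_measurable M"
    and prob_A: "\<And>S. card S = b \<Longrightarrow> prob (A S) = 1 / real (CARD('n) choose b)"
    using mb by (auto simp: minibatch_sampling_def A_def V_def)
  note [measurable] = \<phi>
  have [measurable]: "A S \<in> events" for S
    unfolding A_def by measurable
  have V_nth: "V S $ i = (if i \<in> S then real CARD('n) / real b else 0)" for S i
    by (simp add: V_def axis_def if_distrib[where f = "\<lambda>x. _ * x"] cong: if_cong)
  \<comment> \<open>The entries on \<open>S\<close> are nonzero, so \<open>S\<close> can be read off
    as the support of \<open>V S\<close>.\<close>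
  have inj: "S = T" if "V S = V T" for S T
  proof -
    have "i \<in> S \<longleftrightarrow> i \<in> T" for i
      using arg_cong[OF that, of "\<lambda>x. x $ i"] b by (auto simp: V_nth split: if_splits)
    then show ?thesis by blast
  qed
  have disj: "disjoint_family_on A {S. card S = b}"
    unfolding disjoint_family_on_def A_def by (auto dest: inj)
  have "prob (\<Union>S\<in>{S. card S = b}. A S) = (\<Sum>S | card S = b. prob (A S))"
    by (rule finite_measure_finite_Union[OF _ _ disj]) auto
  also have "\<dots> = real (card {S :: 'n set. card S = b}) / real (CARD('n) choose b)"
    using prob_A by simp
  also have "card {S :: 'n set. card S = b} = CARD('n) choose b"
    using n_subsets[of "UNIV :: 'n set" b] by simp
  finally have "prob (\<Union>S\<in>{S. card S = b}. A S) = 1"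
    using b by simp
  then have "AE \<omega> in M. \<omega> \<in> (\<Union>S\<in>{S. card S = b}. A S)"
    by (subst AE_in_set_eq_1) auto
  then have ae: "AE \<omega> in M. (\<Sum>S | card S = b. indicator (A S) \<omega> *\<^sub>R \<phi> (V S)) = \<phi> (v \<omega>)"
  proof (eventually_elim)
    case (elim \<omega>)
    then obtain S where S: "card S = b" "\<omega> \<in> A S" by blast
    have "(\<Sum>T | card T = b. indicator (A T) \<omega> *\<^sub>R \<phi> (V T))
        = (\<Sum>T | card T = b. if T = S then \<phi> (V T) else 0)"
      using S inj by (intro sum.cong) (auto simp: A_def indicator_def)
    also have "\<dots> = \<phi> (V S)" using S by simp
    finally show ?case using S by (simp add: A_def)
  qed
  have "has_bochner_integral M (\<lambda>\<omega>. \<Sum>S | card S = b. indicator (A S) \<omega> *\<^sub>R \<phi> (V S))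
      (\<Sum>S | card S = b. prob (A S) *\<^sub>R \<phi> (V S))"
    by (intro has_bochner_integral_sum has_bochner_integral_indicator) (auto simp: emeasure_eq_measure)
  moreover have "(\<Sum>S | card S = b. prob (A S) *\<^sub>R \<phi> (V S))
      = (\<Sum>S | card S = b. \<phi> (V S)) / real (CARD('n) choose b)"
    using prob_A by (simp add: sum_divide_distrib)
  ultimately show ?thesis
    using has_bochner_integral_cong_AE[OF _ _ ae] by (simp add: V_def)
qed

text \<open>The weights of a minibatch average to \<open>1\<close>, so subtracting \<open>m\<close>
  amounts to centring every \<open>a i\<close>; the centred vectors sum to zero, as
  \<open>mean_subsets_norm_power2\<close> requires.\<close>

lemma minibatch_second_moment:
  fixes v :: "'w \<Rightarrow> real ^ 'n::finite" and a :: "'n \<Rightarrow> 'a::euclidean_space"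
  assumes "prob_space M" and mb: "minibatch_sampling M b v"
  defines "m \<equiv> (1 / real CARD('n)) *\<^sub>R (\<Sum>i\<in>UNIV. a i)"
  shows "has_bochner_integral M
           (\<lambda>\<omega>. (norm ((1 / real CARD('n)) *\<^sub>R (\<Sum>i\<in>UNIV. v \<omega> $ i *\<^sub>R a i) - m))\<^sup>2)
           ((real CARD('n) - real b) / ((real CARD('n) - 1) * real b)
             * ((1 / real CARD('n)) * (\<Sum>i\<in>UNIV. (norm (a i - m))\<^sup>2)))"
proof -
  have b: "1 \<le> b" "b \<le> CARD('n)"
    using mb by (auto simp: minibatch_sampling_def)
  define \<phi> :: "real ^ 'n \<Rightarrow> real" where
    "\<phi> w = (norm ((1 / real CARD('n)) *\<^sub>R (\<Sum>i\<in>UNIV. w $ i *\<^sub>R a i) - m))\<^sup>2" for w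
  have [measurable]: "\<phi> \<in> borel_measurable borel"
    unfolding \<phi>_def by (intro borel_measurable_continuous_onI continuous_intros)
  have "\<phi> ((real CARD('n) / real b) *\<^sub>R (\<Sum>i\<in>S. axis i 1))
      = (norm ((1 / real b) *\<^sub>R (\<Sum>i\<in>S. a i - m)))\<^sup>2" if "card S = b" for S
  proof -
    have nth: "((real CARD('n) / real b) *\<^sub>R (\<Sum>i\<in>S. axis i 1) :: real ^ 'n) $ i
        = (if i \<in> S then real CARD('n) / real b else 0)" for i
      by (simp add: axis_def if_distrib[where f = "\<lambda>x. _ * x"] cong: if_cong)
    have "(\<Sum>i\<in>UNIV. (if i \<in> S then real CARD('n) / real b else 0) *\<^sub>R a i)
        = (real CARD('n) / real b) *\<^sub>R (\<Sum>i\<in>S. a i)"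
      by (simp add: if_distrib[where f = "\<lambda>x. x *\<^sub>R _"] sum.If_cases scaleR_sum_right cong: if_cong)
    then show ?thesis
      unfolding \<phi>_def nth using that b
      by (simp add: sum_subtractf scaleR_right_diff_distrib sum_constant_scaleR)
  qed
  then have "(\<Sum>S | card S = b. \<phi> ((real CARD('n) / real b) *\<^sub>R (\<Sum>i\<in>S. axis i 1)))
      = (\<Sum>S | card S = b. (norm ((1 / real b) *\<^sub>R (\<Sum>i\<in>S. a i - m)))\<^sup>2)"
    by (intro sum.cong) auto
  moreover have "(\<Sum>i\<in>UNIV. a i - m) = 0"
    by (simp add: m_def sum_subtractf sum_constant_scaleR)
  ultimately show ?thesis
    using minibatch_has_bochner_integral[OF assms(1,2), of \<phi>]
      mean_subsets_norm_power2[OF b, of "\<lambda>i. a i - m"]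
    by (simp only: \<phi>_def) simp
qed

text \<open>The two sides differ by \<open>real CARD('n) * inner m m\<close>, as for a variance and
  a raw second moment.\<close>

lemma sum_norm_power2_centered_le:
  fixes a :: "'n::finite \<Rightarrow> 'a::real_inner"
  defines "m \<equiv> (1 / real CARD('n)) *\<^sub>R (\<Sum>i\<in>UNIV. a i)"
  shows "(\<Sum>i\<in>UNIV. (norm (a i - m))\<^sup>2) \<le> (\<Sum>i\<in>UNIV. (norm (a i))\<^sup>2)"
proof -
  have "(\<Sum>i\<in>UNIV. a i) = real CARD('n) *\<^sub>R m" by (simp add: m_def)
  moreover have "(norm (a i - m))\<^sup>2 = (norm (a i))\<^sup>2 - 2 * inner (a i) m + inner m m" for i
    by (simp add: power2_norm_eq_inner inner_diff_left inner_diff_right inner_commute)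
  then have "(\<Sum>i\<in>UNIV. (norm (a i - m))\<^sup>2)
      = (\<Sum>i\<in>UNIV. (norm (a i))\<^sup>2) - 2 * inner (\<Sum>i\<in>UNIV. a i) m + real CARD('n) * inner m m"
    by (simp add: sum.distrib sum_subtractf inner_sum_left flip: sum_distrib_left)
  ultimately show ?thesis by simp
qed

section \<open>Expected residual and gradient noise\<close>

lemma norm_power2_diff3_le:
  fixes x y z :: "'a::real_inner"
  shows "(norm (x - y - z))\<^sup>2 \<le> 3 * ((norm x)\<^sup>2 + (norm y)\<^sup>2 + (norm z)\<^sup>2)"
proof -
  \<comment> \<open>These three squares add up to exactly the difference of the two sides.\<close>
  have "0 \<le> (norm (x + y))\<^sup>2 + (norm (x + z))\<^sup>2 + (norm (y - z))\<^sup>2" by simp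
  then show ?thesis
    unfolding power2_norm_eq_inner
    by (simp add: inner_diff_left inner_diff_right inner_add_left inner_add_right inner_commute)
qed

lemma expected_residual_exists:
  fixes f :: "'n::finite \<Rightarrow> 'a::euclidean_space \<Rightarrow> real"
  assumes "prob_space M"
    and diff: "\<And>i x. f i differentiable (at x)"
    and smooth: "\<And>i. L_smooth (L i) (f i)"
    and conv: "\<And>xs i. xs \<in> minimizers (objective f) \<Longrightarrow> convex_around xs (f i)"
    and meas: "v \<in> borel_measurable M"
    and int: "\<And>x. integrable M (\<lambda>\<omega>. (norm (stochastic_gradient f v \<omega> x))\<^sup>2)"
  shows "\<exists>\<rho>. expected_residual M (objective f) (stochastic_gradient f v) \<rho>"
proof -
  interpret prob_space M by fact
  let ?n = "real CARD('n)" and ?F = "objective f"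
  have [measurable]: "v \<in> borel_measurable M" by (rule meas)
  \<comment> \<open>Subtracting the full gradients from the stochastic ones replaces the weights
    \<open>v\<close> by \<open>v - 1\<close>, where \<open>1\<close> is the all-ones vector.\<close>
  define u where "u \<omega> = v \<omega> - 1" for \<omega>
  have u: "u \<in> borel_measurable M" unfolding u_def by measurable
  obtain C where C: "0 \<le> C"
    and le: "\<And>a :: 'n \<Rightarrow> 'a. integrable M (\<lambda>\<omega>. (norm (\<Sum>i\<in>UNIV. u \<omega> $ i *\<^sub>R a i))\<^sup>2) \<Longrightarrow>
        (\<integral>\<omega>. (norm (\<Sum>i\<in>UNIV. u \<omega> $ i *\<^sub>R a i))\<^sup>2 \<partial>M) \<le> C * (\<Sum>i\<in>UNIV. (norm (a i))\<^sup>2)"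
    using second_moment_combination_bounded[OF u, where ?'a = 'a] by blast
  \<comment> \<open>Squaring the prefactor gives \<open>1 / ?n\<^sup>2\<close>; one factor stays in
    the constant, the other forms the mean in \<open>mean_gradient_difference_le\<close>.\<close>
  have "expected_residual M ?F (stochastic_gradient f v) (C / ?n * Max (range L))"
    unfolding expected_residual_def
  proof (intro ballI allI)
    fix xs x assume xs: "xs \<in> minimizers ?F"
    let ?a = "\<lambda>i. gradient (f i) x - gradient (f i) xs"
    let ?R = "\<lambda>\<omega>. stochastic_gradient f v \<omega> x - stochastic_gradient f v \<omega> xs
        - (gradient ?F x - gradient ?F xs)"
    have R: "?R \<omega> = (1 / ?n) *\<^sub>R (\<Sum>i\<in>UNIV. u \<omega> $ i *\<^sub>R ?a i)" for \<omega>
      by (simp add: stochastic_gradient_eq[OF diff] gradient_objective[OF diff] u_def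
          sum_subtractf scaleR_left_diff_distrib scaleR_right_diff_distrib)
    have meas_comp: "(\<lambda>\<omega>. u \<omega> $ i) \<in> borel_measurable M" for i
      by (rule measurable_compose[OF u])
        (intro borel_measurable_continuous_onI continuous_intros)
    have intR: "integrable M (\<lambda>\<omega>. (norm (?R \<omega>))\<^sup>2)"
    proof (rule Bochner_Integration.integrable_bound)
      show "integrable M (\<lambda>\<omega>. 3 * ((norm (stochastic_gradient f v \<omega> x))\<^sup>2
          + (norm (stochastic_gradient f v \<omega> xs))\<^sup>2 + (norm (gradient ?F x - gradient ?F xs))\<^sup>2))"
        using int by simp
      show "(\<lambda>\<omega>. (norm (?R \<omega>))\<^sup>2) \<in> borel_measurable M"
        unfolding R using meas_comp by measurable
      show "AE \<omega> in M. norm ((norm (?R \<omega>))\<^sup>2)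
          \<le> norm (3 * ((norm (stochastic_gradient f v \<omega> x))\<^sup>2
          + (norm (stochastic_gradient f v \<omega> xs))\<^sup>2 + (norm (gradient ?F x - gradient ?F xs))\<^sup>2))"
        by (intro AE_I2) (simp add: norm_power2_diff3_le order.trans[OF norm_power2_diff3_le])
    qed
    then have "integrable M (\<lambda>\<omega>. ?n\<^sup>2 * (norm (?R \<omega>))\<^sup>2)" by simp
    then have "integrable M (\<lambda>\<omega>. (norm (\<Sum>i\<in>UNIV. u \<omega> $ i *\<^sub>R ?a i))\<^sup>2)"
      unfolding R by (simp add: power_divide)
    then have "(\<integral>\<omega>. (norm (\<Sum>i\<in>UNIV. u \<omega> $ i *\<^sub>R ?a i))\<^sup>2 \<partial>M)
        \<le> C * (\<Sum>i\<in>UNIV. (norm (?a i))\<^sup>2)"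
      by (rule le)
    then have "(\<integral>\<omega>. (norm (?R \<omega>))\<^sup>2 \<partial>M) \<le> C * (\<Sum>i\<in>UNIV. (norm (?a i))\<^sup>2) / ?n\<^sup>2"
      unfolding R by (simp add: power_divide divide_right_mono)
    also have "\<dots> = C / ?n * ((1 / ?n) * (\<Sum>i\<in>UNIV. (norm (?a i))\<^sup>2))"
      by (simp add: power2_eq_square)
    also have "\<dots> \<le> C / ?n * (2 * Max (range L) * (?F x - ?F xs))"
      using mean_gradient_difference_le[OF diff smooth conv[OF xs] xs] C
      by (intro mult_left_mono) auto
    finally show "integrable M (\<lambda>\<omega>. (norm (?R \<omega>))\<^sup>2) \<and>
        (\<integral>\<omega>. (norm (?R \<omega>))\<^sup>2 \<partial>M) \<le> 2 * (C / ?n * Max (range L)) * (?F x - ?F xs)"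
      using intR by (simp add: mult_ac)
  qed
  then show ?thesis ..
qed

lemma minibatch_factor_nonneg:
  assumes "minibatch_sampling M b (v :: 'w \<Rightarrow> real ^ 'n::finite)"
  shows "0 \<le> (real CARD('n) - real b) / ((real CARD('n) - 1) * real b)"
  using assms by (auto simp: minibatch_sampling_def intro!: divide_nonneg_nonneg)

text \<open>\<open>minibatch_second_moment\<close> gives the second moment of the residual exactly;
  the inequality arises from dropping the centring and from
  \<open>mean_gradient_difference_le\<close>.\<close>

lemma minibatch_expected_residual:
  fixes f :: "'n::finite \<Rightarrow> 'a::euclidean_space \<Rightarrow> real"
  assumes prob: "prob_space M"
    and diff: "\<And>i x. f i differentiable (at x)"
    and smooth: "\<And>i. L_smooth (L i) (f i)"
    and conv: "\<And>xs i. xs \<in> minimizers (objective f) \<Longrightarrow> convex_around xs (f i)"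
    and mb: "minibatch_sampling M b v"
  shows "expected_residual M (objective f) (stochastic_gradient f v)
           (Max (range L) * ((real CARD('n) - real b) / ((real CARD('n) - 1) * real b)))"
  unfolding expected_residual_def
proof (intro ballI allI)
  let ?n = "real CARD('n)" and ?F = "objective f"
  let ?q = "(?n - real b) / ((?n - 1) * real b)"
  fix xs x assume xs: "xs \<in> minimizers ?F"
  let ?a = "\<lambda>i. gradient (f i) x - gradient (f i) xs"
  let ?m = "(1 / ?n) *\<^sub>R (\<Sum>i\<in>UNIV. ?a i)"
  let ?R = "\<lambda>\<omega>. stochastic_gradient f v \<omega> x - stochastic_gradient f v \<omega> xs
      - (gradient ?F x - gradient ?F xs)"
  have R: "?R \<omega> = (1 / ?n) *\<^sub>R (\<Sum>i\<in>UNIV. v \<omega> $ i *\<^sub>R ?a i) - ?m" for \<omega>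
    by (simp add: stochastic_gradient_eq[OF diff] gradient_objective[OF diff]
        sum_subtractf scaleR_right_diff_distrib)
  have "has_bochner_integral M (\<lambda>\<omega>. (norm (?R \<omega>))\<^sup>2)
      (?q * ((1 / ?n) * (\<Sum>i\<in>UNIV. (norm (?a i - ?m))\<^sup>2)))"
    unfolding R by (rule minibatch_second_moment[OF prob mb])
  moreover have "?q * ((1 / ?n) * (\<Sum>i\<in>UNIV. (norm (?a i - ?m))\<^sup>2))
      \<le> ?q * (2 * Max (range L) * (?F x - ?F xs))"
  proof (rule mult_left_mono[OF _ minibatch_factor_nonneg[OF mb]])
    have "(1 / ?n) * (\<Sum>i\<in>UNIV. (norm (?a i - ?m))\<^sup>2) \<le> (1 / ?n) * (\<Sum>i\<in>UNIV. (norm (?a i))\<^sup>2)"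
      by (intro mult_left_mono sum_norm_power2_centered_le) simp
    also have "\<dots> \<le> 2 * Max (range L) * (?F x - ?F xs)"
      by (rule mean_gradient_difference_le[OF diff smooth conv[OF xs] xs])
    finally show "(1 / ?n) * (\<Sum>i\<in>UNIV. (norm (?a i - ?m))\<^sup>2)
        \<le> 2 * Max (range L) * (?F x - ?F xs)" .
  qed
  ultimately show "integrable M (\<lambda>\<omega>. (norm (?R \<omega>))\<^sup>2) \<and>
      (\<integral>\<omega>. (norm (?R \<omega>))\<^sup>2 \<partial>M) \<le> 2 * (Max (range L) * ?q) * (?F x - ?F xs)"
    by (simp add: has_bochner_integral_iff mult_ac)
qed

text \<open>At a minimizer the component gradients have mean zero, so
  \<open>minibatch_second_moment\<close> gives the noise exactly. Its factor is the same for all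
  minimizers and leaves the supremum.\<close>

lemma minibatch_gradient_noise:
  fixes f :: "'n::finite \<Rightarrow> 'a::euclidean_space \<Rightarrow> real"
  assumes prob: "prob_space M"
    and diff: "\<And>i x. f i differentiable (at x)"
    and mb: "minibatch_sampling M b v"
  shows "gradient_noise M (objective f) (stochastic_gradient f v)
           = ennreal (1 / real b * ((real CARD('n) - real b) / (real CARD('n) - 1)))
             * single_element_noise f"
proof -
  let ?n = "real CARD('n)"
  let ?q = "(?n - real b) / ((?n - 1) * real b)"
  have "(\<integral>\<^sup>+\<omega>. ennreal ((norm (stochastic_gradient f v \<omega> xs))\<^sup>2) \<partial>M)
      = ennreal ?q * ennreal ((1 / ?n) * (\<Sum>i\<in>UNIV. (norm (gradient (f i) xs))\<^sup>2))"
    if "xs \<in> minimizers (objective f)" for xs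
  proof -
    have "has_bochner_integral M (\<lambda>\<omega>. (norm (stochastic_gradient f v \<omega> xs))\<^sup>2)
        (?q * ((1 / ?n) * (\<Sum>i\<in>UNIV. (norm (gradient (f i) xs))\<^sup>2)))"
      using minibatch_second_moment[OF prob mb, of "\<lambda>i. gradient (f i) xs"]
        sum_gradient_minimizer[OF diff that]
      by (simp add: stochastic_gradient_eq[OF diff])
    then have "(\<integral>\<^sup>+\<omega>. ennreal ((norm (stochastic_gradient f v \<omega> xs))\<^sup>2) \<partial>M)
        = ennreal (?q * ((1 / ?n) * (\<Sum>i\<in>UNIV. (norm (gradient (f i) xs))\<^sup>2)))"
      by (subst nn_integral_eq_integral) (auto simp: has_bochner_integral_iff)
    also have "\<dots> = ennreal ?q * ennreal ((1 / ?n) * (\<Sum>i\<in>UNIV. (norm (gradient (f i) xs))\<^sup>2))"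
      by (rule ennreal_mult'[OF minibatch_factor_nonneg[OF mb]])
    finally show ?thesis .
  qed
  then have "gradient_noise M (objective f) (stochastic_gradient f v)
      = ennreal ?q * single_element_noise f"
    by (simp add: gradient_noise_def single_element_noise_def SUP_mult_left_ennreal)
  then show ?thesis
    by (simp add: mult.commute)
qed

text \<open>\<open>sampling_vector\<close> controls only first moments, while
  \<open>expected_residual\<close> includes integrability of the squared residual; hence the
  integrability premise of the first part. A minibatch vector takes finitely many values almost
  surely, which supplies integrability there. For \<open>CARD('n) = 1\<close> the quotients read
  \<open>0 / 0 = 0\<close>, which is right since the only batch yields the full gradient.\<close>

theorem proposition3p3:
  fixes f :: "'n::finite \<Rightarrow> real ^ 'd::finite \<Rightarrow> real"
    and L :: "'n \<Rightarrow> real"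
    and M :: "'w measure"
    and v :: "'w \<Rightarrow> real ^ 'n"
  assumes "prob_space M"
    and "\<And>i x. f i differentiable (at x)"
    and "minimizers (objective f) \<noteq> {}"
    and "sampling_vector M v"
    and "\<And>i. L_smooth (L i) (f i)"
    and "\<exists>xs\<in>minimizers (objective f). \<forall>i. convex_around xs (f i)"
  shows "((\<forall>x. integrable M (\<lambda>\<omega>. (norm (stochastic_gradient f v \<omega> x))\<^sup>2)) \<longrightarrow>
           (\<exists>\<rho>. expected_residual M (objective f) (stochastic_gradient f v) \<rho>))
       \<and> (\<forall>b. minibatch_sampling M b v \<longrightarrow>
            expected_residual M (objective f) (stochastic_gradient f v)
              (Max (range L) * ((real CARD('n) - real b) / ((real CARD('n) - 1) * real b)))
          \<and> gradient_noise M (objective f) (stochastic_gradient f v)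
              = ennreal (1 / real b * ((real CARD('n) - real b) / (real CARD('n) - 1)))
                * single_element_noise f)"
proof -
  \<comment> \<open>\<open>expected_residual\<close> quantifies over all minimizers, whereas
    convexity is given around one; \<open>convex_around_minimizers\<close> bridges the gap.\<close>
  obtain ys where "ys \<in> minimizers (objective f)" "\<And>i. convex_around ys (f i)"
    using assms(6) by blast
  then have conv: "convex_around xs (f i)" if "xs \<in> minimizers (objective f)" for xs i
    using convex_around_minimizers[where f = f and xs = ys, OF assms(2,5)] that by blast
  have "v \<in> borel_measurable M"
    using assms(4) by (simp add: sampling_vector_def)
  then show ?thesis
    using expected_residual_exists[where f = f and L = L, OF assms(1,2,5) conv]
      minibatch_expected_residual[where f = f and L = L, OF assms(1,2,5) conv]
      minibatch_gradient_noise[where f = f, OF assms(1,2)]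
    by blast
qed

end
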